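(* If a group $G$ has a Lee metric, then $G\times\mathbb{Z}_2^k$ has a Lee metric for any positive integer $k$.
   Context: All metrics on groups are integral (integer valued) and right translation invariant: $d(gh,g'h)=d(g,g')$ for all $g,g',h\in G$. The weight of $d$ is $w(x)=d(x,e)$, $e$ the identity of $G$. The partition induced by $d$, denoted $P(G,d)$, is the set of classes of the equivalence relation $g\sim h\Leftrightarrow w(g)=w(h)$. Such a metric is gapless if the set of values of $w$ is exactly $\{0,1,\ldots,n\}$ when $P(G,d)$ has finitely many parts, $n$ of them different from $\{e\}$, and is exactly $\mathbb{N}_0=\{0,1,2,\ldots\}$ when $P(G,d)$ has infinitely many parts. The Lee partition of $G$ is $\mathcal{P}_{Lee}(G)=\{\{a,a^{-1}\}:a\in G\}$, the finest partition of $G$ having $\{e\}$ as a part and with all parts closed under inversion. A Lee metric on $G$ is a gapless metric $d$ on $G$ with $P(G,d)=\mathcal{P}_{Lee}(G)$. *)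

theory Defs
  imports "HOL-Algebra.Algebra" "HOL-Analysis.Abstract_Metric_Spaces"
begin

text \<open>
  Metrics are metrics on the carrier in the sense of \<^locale>\<open>Metric_space\<close>. That locale also asks for
  symmetry and nonnegativity outside the carrier, which costs nothing: the distance function of a
  metric on the carrier can be redefined to be 0 there.
\<close>

definition group_metric :: "('a, 'b) monoid_scheme \<Rightarrow> ('a \<Rightarrow> 'a \<Rightarrow> real) \<Rightarrow> bool" where
  "group_metric G d \<longleftrightarrow>
     Metric_space (carrier G) d \<and>
     (\<forall>g\<in>carrier G. \<forall>h\<in>carrier G. d g h \<in> \<int>) \<and>
     (\<forall>g\<in>carrier G. \<forall>g'\<in>carrier G. \<forall>h\<in>carrier G.
        d (g \<otimes>\<^bsub>G\<^esub> h) (g' \<otimes>\<^bsub>G\<^esub> h) = d g g')"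

definition weight :: "('a, 'b) monoid_scheme \<Rightarrow> ('a \<Rightarrow> 'a \<Rightarrow> real) \<Rightarrow> 'a \<Rightarrow> real" where
  "weight G d x = d x \<one>\<^bsub>G\<^esub>"

definition metric_partition :: "('a, 'b) monoid_scheme \<Rightarrow> ('a \<Rightarrow> 'a \<Rightarrow> real) \<Rightarrow> 'a set set" where
  "metric_partition G d =
     carrier G // {(g, h). g \<in> carrier G \<and> h \<in> carrier G \<and> weight G d g = weight G d h}"

definition gapless :: "('a, 'b) monoid_scheme \<Rightarrow> ('a \<Rightarrow> 'a \<Rightarrow> real) \<Rightarrow> bool" where
  "gapless G d \<longleftrightarrow>
     weight G d ` carrier G =
       (if finite (metric_partition G d)
        then real ` {0..card (metric_partition G d - {{\<one>\<^bsub>G\<^esub>}})}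
        else \<nat>)"

definition Lee_partition :: "('a, 'b) monoid_scheme \<Rightarrow> 'a set set" where
  "Lee_partition G = {{a, inv\<^bsub>G\<^esub> a} | a. a \<in> carrier G}"

definition Lee_metric :: "('a, 'b) monoid_scheme \<Rightarrow> ('a \<Rightarrow> 'a \<Rightarrow> real) \<Rightarrow> bool" where
  "Lee_metric G d \<longleftrightarrow>
     group_metric G d \<and> gapless G d \<and> metric_partition G d = Lee_partition G"

definition Z2_power :: "nat \<Rightarrow> (nat \<Rightarrow> int) monoid" where
  "Z2_power k = product_group {..<k} (\<lambda>_. integer_mod_group 2)"

end

(* Right invariant metrics correspond to their weights, so it suffices to extend a weight function w
   on G. The binary value v of an element of Z_2^k takes every value below 2^k once and is
   subadditive, because addition mod 2 without carries never exceeds ordinary addition. Hence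
   (a, x) |-> 2^k * w a + v x is again subadditive and gapless, and it separates exactly the pairs
   {(a, x), (a^-1, x)}, as every x is its own inverse. *)
theory Submission
  imports Defs
begin

text \<open>Characterises the weights of Lee metrics. Gaplessness becomes downward closure of the
  set of values: such a subset of the naturals is an initial segment or everything, so parts need
  not be counted. The third clause also yields definiteness (take \<open>y = \<one>\<close>) and
  invariance under inversion (take \<open>y = inv x\<close>).\<close>

definition Lee_weight :: "('a, 'b) monoid_scheme \<Rightarrow> ('a \<Rightarrow> nat) \<Rightarrow> bool" where
  "Lee_weight G w \<longleftrightarrow>
     w \<one>\<^bsub>G\<^esub> = 0 \<and>
     (\<forall>x\<in>carrier G. \<forall>y\<in>carrier G. w (x \<otimes>\<^bsub>G\<^esub> y) \<le> w x + w y) \<and>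
     (\<forall>x\<in>carrier G. \<forall>y\<in>carrier G. w x = w y \<longleftrightarrow> y = x \<or> y = inv\<^bsub>G\<^esub> x) \<and>
     (\<forall>x\<in>carrier G. \<forall>m\<le>w x. m \<in> w ` carrier G)"

lemma metric_partition_eq_image:
  "metric_partition G d =
     (\<lambda>g. {h \<in> carrier G. weight G d h = weight G d g}) ` carrier G"
proof -
  have "{(g, h). g \<in> carrier G \<and> h \<in> carrier G \<and> weight G d g = weight G d h} `` {g} =
      {h \<in> carrier G. weight G d h = weight G d g}" if "g \<in> carrier G" for g
    using that by auto
  then show ?thesis
    unfolding metric_partition_def quotient_def by (simp add: UNION_singleton_eq_range)
qed

text \<open>Allows the finiteness and the number of parts, on which \<open>gapless\<close> depends,
  to be read off the set of weights.\<close>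

lemma bij_betw_metric_partition:
  "bij_betw (\<lambda>r. {h \<in> carrier G. weight G d h = r}) (weight G d ` carrier G) (metric_partition G d)"
  unfolding bij_betw_def inj_on_def metric_partition_eq_image image_image by blast

lemma Lee_weight_of_Lee_metric:
  fixes G (structure)
  assumes "group G" "Lee_metric G d"
  shows "Lee_weight G (\<lambda>x. nat \<lfloor>weight G d x\<rfloor>)"
proof -
  interpret group G by fact
  have gm: "group_metric G d" and gap: "gapless G d"
    and part: "metric_partition G d = Lee_partition G"
    using assms(2) by (auto simp: Lee_metric_def)
  interpret Metric_space "carrier G" d using gm by (simp add: group_metric_def)
  define w where "w = (\<lambda>x. nat \<lfloor>weight G d x\<rfloor>)"
  \<comment> \<open>Weights are nonnegative integers, so rounding only changes the type.\<close>
  have w: "real (w x) = weight G d x" if "x \<in> carrier G" for x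
  proof -
    have "weight G d x \<in> \<int>" using gm that by (simp add: group_metric_def weight_def)
    moreover have "0 \<le> weight G d x" by (simp add: weight_def)
    ultimately show ?thesis by (auto simp: w_def elim!: Ints_cases)
  qed
  have one: "w \<one> = 0" by (simp add: w_def weight_def)
  have sub: "w (x \<otimes> y) \<le> w x + w y" if x: "x \<in> carrier G" and y: "y \<in> carrier G" for x y
  proof -
    \<comment> \<open>The intermediate point \<open>y\<close> is chosen so that right invariance
      turns the first distance into the weight of \<open>x\<close>.\<close>
    have "d (x \<otimes> y) \<one> \<le> d (x \<otimes> y) (\<one> \<otimes> y) + d y \<one>"
      using triangle[of "x \<otimes> y" y \<one>] x y by simp
    also have "d (x \<otimes> y) (\<one> \<otimes> y) = d x \<one>"
      using gm x y unfolding group_metric_def by blast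
    finally have "real (w (x \<otimes> y)) \<le> real (w x) + real (w y)" using x y by (simp add: w weight_def)
    then show ?thesis by linarith
  qed
  have sep: "w x = w y \<longleftrightarrow> y = x \<or> y = inv x" if x: "x \<in> carrier G" and y: "y \<in> carrier G" for x y
  proof -
    let ?C = "{h \<in> carrier G. weight G d h = weight G d x}"
    have "?C \<in> Lee_partition G" using x part by (auto simp: metric_partition_eq_image)
    then obtain a where a: "a \<in> carrier G" "?C = {a, inv a}" by (auto simp: Lee_partition_def)
    \<comment> \<open>The part is a pair \<open>{a, inv a}\<close> for some unknown
      \<open>a\<close>; since inversion is an involution, either element can serve as
      \<open>a\<close>.\<close>
    have "x \<in> ?C" using x by simp
    then have "x = a \<or> x = inv a" unfolding a(2) by simp
    then have "?C = {x, inv x}" unfolding a(2) using a(1) by auto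
    then have "weight G d y = weight G d x \<longleftrightarrow> y = x \<or> y = inv x" using y by blast
    then show ?thesis using w x y by (metis of_nat_eq_iff)
  qed
  have down: "m \<in> w ` carrier G" if x: "x \<in> carrier G" and m: "m \<le> w x" for x m
  proof -
    have "real (w x) \<in> weight G d ` carrier G" using x w by simp
    \<comment> \<open>Both sets of values allowed by \<open>gapless\<close> are downward closed
      among the naturals.\<close>
    then have "real m \<in> weight G d ` carrier G"
      using gap m unfolding gapless_def by (auto split: if_splits)
    then obtain z where "z \<in> carrier G" "real m = weight G d z" by blast
    then have "m = w z" using w by (metis of_nat_eq_iff)
    then show ?thesis using \<open>z \<in> carrier G\<close> by blast
  qed
  show ?thesis using one sub sep down unfolding w_def Lee_weight_def by blast
qed

lemma Lee_metric_of_Lee_weight: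
  fixes G (structure)
  assumes "group G" "Lee_weight G w"
  shows "\<exists>d. Lee_metric G d"
proof -
  interpret group G by fact
  have one: "w \<one> = 0"
    and sub: "\<And>x y. x \<in> carrier G \<Longrightarrow> y \<in> carrier G \<Longrightarrow> w (x \<otimes> y) \<le> w x + w y"
    and sep: "\<And>x y. x \<in> carrier G \<Longrightarrow> y \<in> carrier G \<Longrightarrow> w x = w y \<longleftrightarrow> y = x \<or> y = inv x"
    and down: "\<And>x m. x \<in> carrier G \<Longrightarrow> m \<le> w x \<Longrightarrow> m \<in> w ` carrier G"
    using assms(2) unfolding Lee_weight_def by blast+
  \<comment> \<open>Right invariance forces this formula on the carrier, by translating with
    \<open>inv y\<close>. The value 0 elsewhere keeps \<open>d\<close> symmetric and nonnegative
    everywhere, as \<open>Metric_space\<close> demands.\<close>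
  define d where
    "d x y = (if x \<in> carrier G \<and> y \<in> carrier G then real (w (x \<otimes> inv y)) else 0)" for x y
  have wt: "weight G d x = real (w x)" if "x \<in> carrier G" for x
    using that by (simp add: weight_def d_def)
  have zero: "w x = 0 \<longleftrightarrow> x = \<one>" if "x \<in> carrier G" for x
    using sep[of \<one> x] that one by auto
  have winv: "w (inv x) = w x" if "x \<in> carrier G" for x
    using sep[of x "inv x"] that by simp
  have "Metric_space (carrier G) d"
  proof
    show "0 \<le> d x y" for x y by (simp add: d_def)
    show "d x y = d y x" for x y
      using winv[of "x \<otimes> inv y"] by (auto simp: d_def inv_mult_group)
    show "d x y = 0 \<longleftrightarrow> x = y" if "x \<in> carrier G" "y \<in> carrier G" for x y
      using that zero[of "x \<otimes> inv y"] inv_solve_right'[of \<one> x y] by (auto simp: d_def)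
    show "d x z \<le> d x y + d y z"
      if "x \<in> carrier G" "y \<in> carrier G" "z \<in> carrier G" for x y z
    proof -
      have "inv y \<otimes> (y \<otimes> inv z) = inv z"
        using that by (simp flip: m_assoc)
      then have "(x \<otimes> inv y) \<otimes> (y \<otimes> inv z) = x \<otimes> inv z"
        using that by (simp add: m_assoc)
      then show ?thesis using sub[of "x \<otimes> inv y" "y \<otimes> inv z"] that by (simp add: d_def)
    qed
  qed
  moreover have "d (g \<otimes> h) (g' \<otimes> h) = d g g'"
    if "g \<in> carrier G" "g' \<in> carrier G" "h \<in> carrier G" for g g' h
  proof -
    have "h \<otimes> (inv h \<otimes> inv g') = inv g'"
      using that by (simp flip: m_assoc)
    then have "(g \<otimes> h) \<otimes> inv (g' \<otimes> h) = g \<otimes> inv g'"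
      using that by (simp add: inv_mult_group m_assoc)
    then show ?thesis using that by (simp add: d_def)
  qed
  ultimately have gm: "group_metric G d"
    by (simp add: group_metric_def) (simp add: d_def)
  have cls: "{h \<in> carrier G. weight G d h = weight G d g} = {g, inv g}" if "g \<in> carrier G" for g
  proof -
    have "weight G d h = weight G d g \<longleftrightarrow> h = g \<or> h = inv g" if "h \<in> carrier G" for h
      using sep[of g h] wt \<open>g \<in> carrier G\<close> that by auto
    then show ?thesis using that by auto
  qed
  have part: "metric_partition G d = Lee_partition G"
    unfolding metric_partition_eq_image Lee_partition_def using cls by auto
  have img: "weight G d ` carrier G = real ` (w ` carrier G)"
    using wt by (simp add: image_image)
  have fin: "finite (metric_partition G d) \<longleftrightarrow> finite (w ` carrier G)"
    using bij_betw_finite[OF bij_betw_metric_partition[of G d]] img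
    by (simp add: finite_image_iff)
  have "card (metric_partition G d) = card (w ` carrier G)"
    using bij_betw_same_card[OF bij_betw_metric_partition[of G d]] img
    by (simp add: card_image)
  \<comment> \<open>The class of the identity is the pair \<open>{\<one>, inv \<one>}\<close>; when
    there are finitely many parts, discarding it lowers their number by exactly one.\<close>
  moreover have "{\<one>} \<in> metric_partition G d"
    unfolding part Lee_partition_def using one_closed inv_one by force
  ultimately have card: "card (metric_partition G d - {{\<one>}}) = card (w ` carrier G) - 1"
    by simp
  have "gapless G d"
  proof (cases "finite (w ` carrier G)")
    case True
    let ?M = "Max (w ` carrier G)"
    have ne: "w ` carrier G \<noteq> {}" using one_closed by blast
    have "?M \<in> w ` carrier G" using Max_in[OF True ne] .
    then have "{0..?M} \<subseteq> w ` carrier G" using down by auto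
    moreover have "w ` carrier G \<subseteq> {0..?M}" using True by auto
    ultimately have "w ` carrier G = {0..?M}" by blast
    \<comment> \<open>The segment \<open>{0..?M}\<close> has \<open>?M + 1\<close> elements, so
      \<open>?M\<close> is the number of parts other than that of the identity.\<close>
    then have "w ` carrier G = {0..card (w ` carrier G) - 1}"
      by (metis card_atLeastAtMost diff_Suc_1 diff_zero)
    then show ?thesis using True unfolding gapless_def fin card img by simp
  next
    case False
    \<comment> \<open>An infinite set of naturals is unbounded, so downward closure reaches every
      \<open>m\<close>.\<close>
    have "m \<in> w ` carrier G" for m
    proof -
      obtain x where "x \<in> carrier G" "m \<le> w x"
        using False unfolding infinite_nat_iff_unbounded_le by blast
      then show ?thesis by (rule down)
    qed
    then have "w ` carrier G = UNIV" by blast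
    then show ?thesis using False unfolding gapless_def fin img Nats_def by simp
  qed
  then show ?thesis using gm part unfolding Lee_metric_def by blast
qed

text \<open>As \<open>v\<close> stays below \<open>m\<close>, the numbers \<open>w a\<close> and
  \<open>v x\<close> are the quotient and remainder of the new weight on division by
  \<open>m\<close>, so the two factors can be treated separately.\<close>

lemma Lee_weight_DirProd:
  assumes "group G" "group H" and w: "Lee_weight G w"
    and inv: "\<And>x. x \<in> carrier H \<Longrightarrow> inv\<^bsub>H\<^esub> x = x"
    and bij: "bij_betw v (carrier H) {..<m}"
    and v_one: "v \<one>\<^bsub>H\<^esub> = 0"
    and v_mult: "\<And>x y. x \<in> carrier H \<Longrightarrow> y \<in> carrier H \<Longrightarrow> v (x \<otimes>\<^bsub>H\<^esub> y) \<le> v x + v y"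
  shows "Lee_weight (G \<times>\<times> H) (\<lambda>(a, x). m * w a + v x)"
proof -
  interpret G: group G by fact
  interpret H: group H by fact
  have w_one: "w \<one>\<^bsub>G\<^esub> = 0"
    and sub: "\<And>x y. x \<in> carrier G \<Longrightarrow> y \<in> carrier G \<Longrightarrow> w (x \<otimes>\<^bsub>G\<^esub> y) \<le> w x + w y"
    and sep: "\<And>x y. x \<in> carrier G \<Longrightarrow> y \<in> carrier G \<Longrightarrow> w x = w y \<longleftrightarrow> y = x \<or> y = inv\<^bsub>G\<^esub> x"
    and down: "\<And>x m. x \<in> carrier G \<Longrightarrow> m \<le> w x \<Longrightarrow> m \<in> w ` carrier G"
    using w unfolding Lee_weight_def by blast+
  have lt: "v x < m" if "x \<in> carrier H" for x
    using bij that by (auto simp: bij_betw_def)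
  have divmod: "(m * w a + v x) div m = w a" "(m * w a + v x) mod m = v x"
    if "x \<in> carrier H" for a x
    using lt[OF that] by auto
  have "m * w (a \<otimes>\<^bsub>G\<^esub> b) + v (x \<otimes>\<^bsub>H\<^esub> y) \<le> m * w a + v x + (m * w b + v y)"
    if "a \<in> carrier G" "b \<in> carrier G" "x \<in> carrier H" "y \<in> carrier H" for a b x y
    using mult_le_mono2[OF sub[OF that(1,2)], of m] v_mult[OF that(3,4)]
    by (simp add: distrib_left)
  moreover have "m * w a + v x = m * w b + v y \<longleftrightarrow>
      (b, y) = (a, x) \<or> (b, y) = (inv\<^bsub>G\<^esub> a, inv\<^bsub>H\<^esub> x)"
    if "a \<in> carrier G" "b \<in> carrier G" "x \<in> carrier H" "y \<in> carrier H" for a b x y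
  proof -
    have "m * w a + v x = m * w b + v y \<longleftrightarrow> w a = w b \<and> v x = v y"
      using divmod that by metis
    moreover have "v x = v y \<longleftrightarrow> y = x"
      using bij that by (auto simp: bij_betw_def inj_on_def)
    \<comment> \<open>Here \<open>inv x = x\<close> matters: the injective \<open>v\<close> would
      otherwise tell \<open>(a, x)\<close> apart from its inverse.\<close>
    ultimately show ?thesis using sep inv that by auto
  qed
  moreover have "r \<in> (\<lambda>(a, x). m * w a + v x) ` (carrier G \<times> carrier H)"
    if a: "a \<in> carrier G" and x: "x \<in> carrier H" and r: "r \<le> m * w a + v x" for a x r
  proof -
    have "r div m \<le> w a" using div_le_mono[OF r, of m] divmod(1)[OF x] by simp
    then obtain b where b: "b \<in> carrier G" "r div m = w b" using down a by blast
    \<comment> \<open>The bound \<open>v x < m\<close> ensures \<open>m > 0\<close>, so the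
      remainder lies in the range of \<open>v\<close>.\<close>
    have "r mod m \<in> v ` carrier H"
      using bij lt[OF x] by (simp add: bij_betw_def)
    then obtain y where y: "y \<in> carrier H" "r mod m = v y" by blast
    have "r = m * w b + v y" using b y by (metis mult_div_mod_eq)
    then show ?thesis using b y by force
  qed
  ultimately show ?thesis
    unfolding Lee_weight_def by (auto simp: w_one v_one inv_DirProd[OF assms(1,2)])
qed

lemma group_Z2_power: "group (Z2_power k)"
  unfolding Z2_power_def by simp

lemma carrier_Z2_power: "carrier (Z2_power k) = {..<k} \<rightarrow>\<^sub>E {0..<2}"
  by (simp add: Z2_power_def carrier_integer_mod_group)

lemma inv_Z2_power:
  assumes "x \<in> carrier (Z2_power k)"
  shows "inv\<^bsub>Z2_power k\<^esub> x = x"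
proof -
  interpret group "Z2_power k" by (rule group_Z2_power)
  have "(x i + x i) mod 2 = 0" for i by presburger
  then have "x \<otimes>\<^bsub>Z2_power k\<^esub> x = \<one>\<^bsub>Z2_power k\<^esub>"
    unfolding Z2_power_def by (simp add: mult_integer_mod_group)
  then show ?thesis using assms inv_equality by blast
qed

definition binary_value :: "nat \<Rightarrow> (nat \<Rightarrow> int) \<Rightarrow> nat" where
  "binary_value k x = (\<Sum>i<k. nat (x i) * 2 ^ i)"

lemma binary_value_one: "binary_value k \<one>\<^bsub>Z2_power k\<^esub> = 0"
  by (simp add: binary_value_def Z2_power_def)

text \<open>Reducing the sum of two digits mod 2 can only decrease it; the inequality is then summed
  with the weights \<open>2 ^ i\<close>.\<close>

lemma binary_value_mult_le:
  assumes "x \<in> carrier (Z2_power k)" "y \<in> carrier (Z2_power k)"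
  shows "binary_value k (x \<otimes>\<^bsub>Z2_power k\<^esub> y) \<le> binary_value k x + binary_value k y"
proof -
  have "nat ((x \<otimes>\<^bsub>Z2_power k\<^esub> y) i) \<le> nat (x i) + nat (y i)" if "i < k" for i
  proof -
    have "x i \<in> {0..<2}" "y i \<in> {0..<2}"
      using assms that PiE_mem lessThan_iff unfolding carrier_Z2_power by metis+
    then have "0 \<le> x i" "0 \<le> y i" by simp_all
    then have "(x i + y i) mod 2 \<le> x i + y i" by (simp add: zmod_le_nonneg_dividend)
    then show ?thesis using that \<open>0 \<le> x i\<close> \<open>0 \<le> y i\<close>
      by (simp add: Z2_power_def mult_integer_mod_group)
  qed
  then show ?thesis
    unfolding binary_value_def sum.distrib[symmetric] distrib_right[symmetric]
    by (intro sum_mono mult_right_mono) simp_all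
qed

text \<open>Binary expansion gives surjectivity, and injectivity follows by counting, since both
  sides have \<open>2 ^ k\<close> elements.\<close>

lemma bij_betw_binary_value: "bij_betw (binary_value k) (carrier (Z2_power k)) {..<2 ^ k}"
proof -
  let ?C = "carrier (Z2_power k)"
  have fin: "finite ?C" and card: "card ?C = 2 ^ k"
    by (simp_all add: carrier_Z2_power finite_PiE card_PiE)
  have "{..<2 ^ k} \<subseteq> binary_value k ` ?C"
  proof
    fix n :: nat assume n: "n \<in> {..<2 ^ k}"
    \<comment> \<open>The lowest \<open>k\<close> bits of \<open>n\<close>, restricted because
      elements of the product group are extensional functions.\<close>
    let ?x = "restrict (\<lambda>i. of_bool (bit n i)) {..<k}"
    have "binary_value k ?x = (\<Sum>i=0..<k. push_bit i (of_bool (bit n i)))"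
      unfolding binary_value_def by (intro sum.cong) (auto simp: push_bit_eq_mult)
    also have "\<dots> = take_bit k n" by (rule take_bit_sum[symmetric])
    also have "\<dots> = n" using n by (simp add: take_bit_nat_eq_self)
    finally have "n = binary_value k ?x" ..
    moreover have "?x \<in> ?C" by (auto simp: carrier_Z2_power)
    ultimately show "n \<in> binary_value k ` ?C" by blast
  qed
  \<comment> \<open>The image has at most \<open>2 ^ k\<close> elements, so it cannot exceed the
    subset just found; this also bounds the values by \<open>2 ^ k\<close>.\<close>
  then have img: "{..<2 ^ k} = binary_value k ` ?C"
    using card_image_le[OF fin, of "binary_value k"] card fin by (intro card_seteq) auto
  have "card (binary_value k ` ?C) = card ?C" unfolding img[symmetric] card by simp
  then have "inj_on (binary_value k) ?C" by (rule eq_card_imp_inj_on[OF fin])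
  then show ?thesis unfolding bij_betw_def using img[symmetric] ..
qed

theorem proposition3p2:
  fixes G :: "('a, 'b) monoid_scheme" and k :: nat
  assumes "group G"
    and "\<exists>d. Lee_metric G d"
    and "k > 0"
  shows "\<exists>d. Lee_metric (G \<times>\<times> Z2_power k) d"
proof -
  obtain d where "Lee_metric G d" using assms(2) ..
  then obtain w where "Lee_weight G w" using Lee_weight_of_Lee_metric[OF assms(1)] by iprover
  then have "Lee_weight (G \<times>\<times> Z2_power k) (\<lambda>(a, x). 2 ^ k * w a + binary_value k x)"
    by (intro Lee_weight_DirProd assms(1) group_Z2_power inv_Z2_power bij_betw_binary_value
        binary_value_one binary_value_mult_le)
  with DirProd_group[OF assms(1) group_Z2_power] show ?thesis
    by (rule Lee_metric_of_Lee_weight)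
qed

end
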